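(* Let $G$ be a connected graph with $n = |V(G)| \ge 3$. Then $\textrm{RED:LD}(G) = n$ if and only if every vertex of $G$ is a leaf, a support vertex, or a twin of some other vertex.
   Context: A leaf is a vertex of degree 1; a support vertex is a vertex adjacent to a leaf. Two distinct vertices $u,v$ are twins if $N[u]=N[v]$ or $N(u)=N(v)$, where $N(v)$ is the open neighborhood and $N[v]=N(v)\cup\{v\}$. A set $S \subseteq V(G)$ is a locating-dominating (LD) set if for all $u,v \in V(G)-S$: $N(v)\cap S \neq \varnothing$, and if $u \ne v$ then $N(v) \cap S \neq N(u) \cap S$. A RED:LD set is an LD set $S$ such that $S-\{v\}$ is an LD set for every $v \in S$. $\textrm{RED:LD}(G)$ is the minimum cardinality of a RED:LD set of $G$. *)

theory Defs
  imports "Graph_Theory.Digraph_Component"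
begin

text \<open>
  A finite simple undirected graph is an instance of the locale \<^locale>\<open>graph\<close>: a finite symmetric
  digraph without loops and without parallel arcs.  Each undirected edge is a pair of opposite arcs,
  so the degree of a vertex is its \<^const>\<open>out_degree\<close>.
\<close>

definition open_nbhd :: "('a, 'b) pre_digraph \<Rightarrow> 'a \<Rightarrow> 'a set" where
  "open_nbhd G v = {u \<in> verts G. v \<rightarrow>\<^bsub>G\<^esub> u}"

definition closed_nbhd :: "('a, 'b) pre_digraph \<Rightarrow> 'a \<Rightarrow> 'a set" where
  "closed_nbhd G v = open_nbhd G v \<union> {v}"

definition is_leaf :: "('a, 'b) pre_digraph \<Rightarrow> 'a \<Rightarrow> bool" where
  "is_leaf G v \<longleftrightarrow> v \<in> verts G \<and> out_degree G v = 1"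

definition is_support_vertex :: "('a, 'b) pre_digraph \<Rightarrow> 'a \<Rightarrow> bool" where
  "is_support_vertex G v \<longleftrightarrow> v \<in> verts G \<and> (\<exists>u. is_leaf G u \<and> v \<rightarrow>\<^bsub>G\<^esub> u)"

definition twins :: "('a, 'b) pre_digraph \<Rightarrow> 'a \<Rightarrow> 'a \<Rightarrow> bool" where
  "twins G u v \<longleftrightarrow> u \<in> verts G \<and> v \<in> verts G \<and> u \<noteq> v \<and>
     (closed_nbhd G u = closed_nbhd G v \<or> open_nbhd G u = open_nbhd G v)"

definition LD_set :: "('a, 'b) pre_digraph \<Rightarrow> 'a set \<Rightarrow> bool" where
  "LD_set G S \<longleftrightarrow> S \<subseteq> verts G \<and>
     (\<forall>u \<in> verts G - S. \<forall>v \<in> verts G - S.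
        open_nbhd G v \<inter> S \<noteq> {} \<and>
        (u \<noteq> v \<longrightarrow> open_nbhd G v \<inter> S \<noteq> open_nbhd G u \<inter> S))"

definition RED_LD_set :: "('a, 'b) pre_digraph \<Rightarrow> 'a set \<Rightarrow> bool" where
  "RED_LD_set G S \<longleftrightarrow> LD_set G S \<and> (\<forall>v \<in> S. LD_set G (S - {v}))"

text \<open>
  The minimum below is attained whenever \<open>G\<close> has no isolated vertex, since then \<open>verts G\<close> itself
  is a RED:LD set; otherwise there is no RED:LD set and the value is unspecified.
\<close>

definition RED_LD :: "('a, 'b) pre_digraph \<Rightarrow> nat" where
  "RED_LD G = (LEAST k. \<exists>S. RED_LD_set G S \<and> card S = k)"

end

theory Submission
  imports Defs
begin

text \<open>
  A leaf outside \<open>S\<close> loses its only dominator when its neighbour is removed, a support vertex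
  outside \<open>S\<close> leaves its leaf undominated when that leaf is removed, and twins are never separated by
  a set avoiding both; so every RED:LD set contains all vertices of these three kinds.  Conversely,
  if \<open>v\<close> is of none of these kinds, then \<open>verts G - {v}\<close> is a RED:LD set: the only pair to
  separate after removing \<open>w\<close> is \<open>{v, w}\<close>, and failure to do so would make \<open>v\<close> and \<open>w\<close> twins.
\<close>

text \<open>Taking \<open>u = v\<close> frees domination from the second quantifier; separation is
  then injectivity of the trace on \<open>S\<close>, so a complement of one or two vertices is easy
  to check.\<close>

lemma LD_set_iff:
  "LD_set G S \<longleftrightarrow> S \<subseteq> verts G \<and> (\<forall>v \<in> verts G - S. open_nbhd G v \<inter> S \<noteq> {}) \<and>
     inj_on (\<lambda>v. open_nbhd G v \<inter> S) (verts G - S)"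
  unfolding LD_set_def inj_on_def by metis

lemma LD_set_dominates:
  "LD_set G S \<Longrightarrow> v \<in> verts G \<Longrightarrow> v \<notin> S \<Longrightarrow> open_nbhd G v \<inter> S \<noteq> {}"
  by (simp add: LD_set_iff)

lemma LD_set_separates:
  "LD_set G S \<Longrightarrow> u \<in> verts G - S \<Longrightarrow> v \<in> verts G - S \<Longrightarrow>
    open_nbhd G u \<inter> S = open_nbhd G v \<inter> S \<Longrightarrow> u = v"
  by (auto simp: LD_set_iff dest: inj_onD)

text \<open>Passing from closed to open neighbourhoods changes only the memberships of
  \<open>u\<close> and \<open>v\<close>, which \<open>S\<close> does not see.\<close>

lemma twins_open_nbhd_Int:
  assumes "twins G u v" "u \<notin> S" "v \<notin> S"
  shows "open_nbhd G u \<inter> S = open_nbhd G v \<inter> S"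
  using assms unfolding twins_def closed_nbhd_def by blast

lemma RED_LD_set_subset: "RED_LD_set G S \<Longrightarrow> S \<subseteq> verts G"
  by (simp add: RED_LD_set_def LD_set_def)

context graph
begin

lemma open_nbhd_subset: "open_nbhd G v \<subseteq> verts G"
  by (auto simp: open_nbhd_def)

lemma open_nbhd_sym: "u \<in> open_nbhd G v \<longleftrightarrow> v \<in> open_nbhd G u"
  by (auto simp: open_nbhd_def intro: graph_symmetric adj_in_verts)

lemma not_in_open_nbhd [simp]: "v \<notin> open_nbhd G v"
  by (auto simp: open_nbhd_def dest: adj_not_same)

text \<open>Without parallel arcs, an arc leaving \<open>v\<close> is determined by its head, so
  counting arcs counts neighbours.\<close>

lemma out_degree_eq_card_open_nbhd: "out_degree G v = card (open_nbhd G v)"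
proof -
  have "inj_on (head G) (out_arcs G v)"
    by (rule inj_onI) (auto simp: arc_to_ends_def intro: no_multi_arcs)
  moreover have "open_nbhd G v = head G ` out_arcs G v"
    by (auto simp: open_nbhd_def arcs_ends_conv)
  ultimately show ?thesis
    by (simp add: out_degree_def card_image)
qed

lemma is_leaf_iff: "is_leaf G v \<longleftrightarrow> v \<in> verts G \<and> (\<exists>u. open_nbhd G v = {u})"
  by (auto simp: is_leaf_def out_degree_eq_card_open_nbhd card_1_singleton_iff)

lemma is_support_vertex_iff:
  "is_support_vertex G v \<longleftrightarrow> (\<exists>u \<in> verts G. open_nbhd G u = {v})"
proof
  assume "is_support_vertex G v"
  then obtain u w where u: "u \<in> verts G" "open_nbhd G u = {w}" "u \<in> open_nbhd G v"
    by (auto simp: is_support_vertex_def is_leaf_iff open_nbhd_def)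
  then have "v \<in> open_nbhd G u"
    using open_nbhd_sym by blast
  with u show "\<exists>u \<in> verts G. open_nbhd G u = {v}"
    by auto
next
  assume "\<exists>u \<in> verts G. open_nbhd G u = {v}"
  then obtain u where u: "u \<in> verts G" "open_nbhd G u = {v}" by blast
  then have "u \<in> open_nbhd G v" "v \<in> verts G"
    using open_nbhd_sym open_nbhd_subset by blast+
  with u show "is_support_vertex G v"
    by (auto simp: is_support_vertex_def is_leaf_iff open_nbhd_def)
qed

lemma connected_open_nbhd_nonempty:
  assumes "connected G" "card (verts G) \<ge> 2" "v \<in> verts G"
  shows "open_nbhd G v \<noteq> {}"
proof -
  have "\<not> verts G \<subseteq> {v}"
    using assms(2) card_mono[of "{v}" "verts G"] by auto
  then obtain w where w: "w \<in> verts G" "w \<noteq> v"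
    by blast
  have "v \<rightarrow>\<^sup>*\<^bsub>mk_symmetric G\<^esub> w"
    using assms(1,3) w(1) by (auto simp: connected_def strongly_connected_def)
  \<comment> \<open>Connectedness speaks of the symmetric closure, which has the same reachability
    because \<open>G\<close> is already symmetric; the first arc of a walk to \<open>w\<close> then
    gives a neighbour of \<open>v\<close>.\<close>
  then have "v \<rightarrow>\<^sup>* w"
    by (simp only: reachable_mk_symmetric_eq[OF sym_arcs])
  then show ?thesis
    using w(2) by (cases rule: converse_reachable_cases) (auto simp: open_nbhd_def dest: adj_in_verts)
qed

lemma RED_LD_set_contains_leaf:
  assumes "RED_LD_set G S" "is_leaf G v"
  shows "v \<in> S"
proof (rule ccontr)
  assume "v \<notin> S"
  obtain u where u: "v \<in> verts G" "open_nbhd G v = {u}"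
    using assms(2) by (auto simp: is_leaf_iff)
  \<comment> \<open>The only possible dominator of \<open>v\<close> must lie in \<open>S\<close>, so
    redundancy allows its removal.\<close>
  have "u \<in> S"
    using LD_set_dominates[of G S v] assms(1) u \<open>v \<notin> S\<close> by (auto simp: RED_LD_set_def)
  then show False
    using LD_set_dominates[of G "S - {u}" v] assms(1) u \<open>v \<notin> S\<close> by (auto simp: RED_LD_set_def)
qed

lemma RED_LD_set_contains_support_vertex:
  assumes "RED_LD_set G S" "is_support_vertex G v"
  shows "v \<in> S"
proof (rule ccontr)
  assume "v \<notin> S"
  obtain u where u: "u \<in> verts G" "open_nbhd G u = {v}"
    using assms(2) by (auto simp: is_support_vertex_iff)
  then have "u \<in> S"
    using RED_LD_set_contains_leaf[OF assms(1)] by (auto simp: is_leaf_iff)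
  then show False
    using LD_set_dominates[of G "S - {u}" u] assms(1) u \<open>v \<notin> S\<close> by (auto simp: RED_LD_set_def)
qed

lemma RED_LD_set_contains_twin:
  assumes "RED_LD_set G S" "twins G v u"
  shows "v \<in> S"
proof (rule ccontr)
  assume "v \<notin> S"
  \<comment> \<open>Redundancy covers only members of \<open>S\<close>; if \<open>u\<close> lies
    outside, the set is \<open>S\<close> itself. Either way both twins are now outside.\<close>
  have "LD_set G (S - {u})"
    using assms(1) by (cases "u \<in> S") (auto simp: RED_LD_set_def)
  moreover have "open_nbhd G v \<inter> (S - {u}) = open_nbhd G u \<inter> (S - {u})"
    using twins_open_nbhd_Int[OF assms(2)] \<open>v \<notin> S\<close> by blast
  ultimately show False
    using LD_set_separates[of G "S - {u}" v u] assms(2) \<open>v \<notin> S\<close> by (auto simp: twins_def)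
qed

text \<open>With a single vertex missing there is no pair to separate, and without loops all its
  neighbours remain in the set.\<close>

lemma RED_LD_set_verts:
  assumes "\<And>v. v \<in> verts G \<Longrightarrow> open_nbhd G v \<noteq> {}"
  shows "RED_LD_set G (verts G)"
proof -
  have "open_nbhd G v \<inter> (verts G - {v}) \<noteq> {}" if "v \<in> verts G" for v
    using assms[OF that] open_nbhd_subset[of v] not_in_open_nbhd[of v] by blast
  then show ?thesis
    by (auto simp: RED_LD_set_def LD_set_iff double_diff)
qed

lemma RED_LD_set_verts_Diff:
  assumes nonempty: "\<And>v. v \<in> verts G \<Longrightarrow> open_nbhd G v \<noteq> {}"
    and v: "v \<in> verts G" "\<not> is_leaf G v" "\<not> is_support_vertex G v" "\<And>u. \<not> twins G v u"
  shows "RED_LD_set G (verts G - {v})"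
proof -
  let ?N = "open_nbhd G"
  have "LD_set G (verts G - {v})"
    using nonempty[OF v(1)] open_nbhd_subset[of v] not_in_open_nbhd[of v] v(1)
    by (auto simp: LD_set_iff double_diff)
  moreover have "LD_set G (verts G - {v} - {w})" if w: "w \<in> verts G - {v}" for w
  proof -
    let ?S = "verts G - {v} - {w}"
    \<comment> \<open>Injectivity on this pair is the single inequality of the two traces computed
      next.\<close>
    have compl: "verts G - ?S = {v, w}"
      using v(1) w by blast
    have Int: "?N v \<inter> ?S = ?N v - {w}" "?N w \<inter> ?S = ?N w - {v}"
      using open_nbhd_subset[of v] open_nbhd_subset[of w] not_in_open_nbhd[of v]
        not_in_open_nbhd[of w] by blast+
    \<comment> \<open>Otherwise \<open>w\<close> would be the only neighbour of \<open>v\<close>,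
      making \<open>v\<close> a leaf; in the symmetric case below, \<open>v\<close> would support
      the leaf \<open>w\<close>.\<close>
    have "?N v - {w} \<noteq> {}"
      using nonempty[OF v(1)] v(1,2) by (auto simp: is_leaf_iff)
    moreover have "?N w - {v} \<noteq> {}"
      using nonempty[of w] v(3) w by (auto simp: is_support_vertex_iff)
    moreover have "?N v - {w} \<noteq> ?N w - {v}"
    proof
      assume eq: "?N v - {w} = ?N w - {v}"
      have "twins G v w"
      \<comment> \<open>Adjacency decides the kind of twins: adjacent vertices get equal closed
        neighbourhoods, and for non-adjacent ones the set differences remove nothing.\<close>
      proof (cases "w \<in> ?N v")
        case True
        then have "v \<in> ?N w" by (simp add: open_nbhd_sym)
        with True eq have "closed_nbhd G v = closed_nbhd G w"
          unfolding closed_nbhd_def by blast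
        with v(1) w show ?thesis by (auto simp: twins_def)
      next
        case False
        then have "v \<notin> ?N w" by (simp add: open_nbhd_sym)
        with False eq have "?N v = ?N w" by blast
        with v(1) w show ?thesis by (auto simp: twins_def)
      qed
      with v(4) show False by blast
    qed
    ultimately show ?thesis
      unfolding LD_set_iff compl by (auto simp: Int)
  qed
  ultimately show ?thesis
    by (simp add: RED_LD_set_def)
qed

text \<open>Turns the numerical claim into one about sets: in the finite \<open>verts G\<close>, a
  subset of full cardinality is everything.\<close>

lemma RED_LD_eq_card_verts_iff:
  assumes "RED_LD_set G (verts G)"
  shows "RED_LD G = card (verts G) \<longleftrightarrow> (\<forall>S. RED_LD_set G S \<longrightarrow> S = verts G)"
proof
  assume eq: "RED_LD G = card (verts G)"
  show "\<forall>S. RED_LD_set G S \<longrightarrow> S = verts G"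
  proof (intro allI impI)
    fix S assume S: "RED_LD_set G S"
    then have "RED_LD G \<le> card S"
      unfolding RED_LD_def by (blast intro: Least_le)
    with S eq show "S = verts G"
      by (simp add: card_seteq RED_LD_set_subset)
  qed
next
  assume "\<forall>S. RED_LD_set G S \<longrightarrow> S = verts G"
  then show "RED_LD G = card (verts G)"
    unfolding RED_LD_def using assms by (intro Least_equality; blast)
qed

end

theorem theorem5:
  fixes G :: "('a, 'b) pre_digraph"
  assumes "graph G"
    and "connected G"
    and "card (verts G) \<ge> 3"
  shows "RED_LD G = card (verts G) \<longleftrightarrow>
    (\<forall>v \<in> verts G. is_leaf G v \<or> is_support_vertex G v \<or> (\<exists>u \<in> verts G. twins G v u))"
proof -
  interpret graph G by fact
  have nonempty: "open_nbhd G v \<noteq> {}" if "v \<in> verts G" for v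
    using connected_open_nbhd_nonempty that assms(2,3) by simp
  have "(\<forall>S. RED_LD_set G S \<longrightarrow> S = verts G) \<longleftrightarrow>
    (\<forall>v \<in> verts G. is_leaf G v \<or> is_support_vertex G v \<or> (\<exists>u \<in> verts G. twins G v u))"
    (is "?L \<longleftrightarrow> ?R")
  proof
    assume ?L
    show ?R
    proof (rule ccontr)
      assume "\<not> ?R"
      \<comment> \<open>By \<open>twins_def\<close> a twin is always a vertex, so having no twin in
        \<open>verts G\<close> means having none at all.\<close>
      then obtain v where "v \<in> verts G" "RED_LD_set G (verts G - {v})"
        using RED_LD_set_verts_Diff[OF nonempty] by (auto simp: twins_def)
      with \<open>?L\<close> show False by blast
    qed
  next
    assume ?R
    have "S = verts G" if S: "RED_LD_set G S" for S
    proof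
      show "S \<subseteq> verts G" by (rule RED_LD_set_subset[OF S])
      show "verts G \<subseteq> S"
        using \<open>?R\<close> RED_LD_set_contains_leaf[OF S] RED_LD_set_contains_support_vertex[OF S]
          RED_LD_set_contains_twin[OF S] by blast
    qed
    then show ?L by blast
  qed
  then show ?thesis
    using RED_LD_eq_card_verts_iff[OF RED_LD_set_verts[OF nonempty]] by simp
qed

end
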